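(* For integers $n\ge 0$ and $i$, let $$Q_{n,i}(x_1,\ldots,x_5,y_1,\ldots,y_{14})=\sum_{\substack{\sigma\in\mathcal{S}_n(132)\\ \mathrm{occr}_{12}(\sigma)=i}}\ \prod_{a=1}^{5}x_a^{\mathrm{occr}_{\alpha_a}(\sigma)}\prod_{b=1}^{14}y_b^{\mathrm{occr}_{\beta_b}(\sigma)},$$ where $(\alpha_1,\ldots,\alpha_5)=(123,213,231,312,321)$ and $$(\beta_1,\ldots,\beta_{14})=(1234,2134,2314,2341,3124,3214,3241,3412,3421,4123,4213,4231,4312,4321).$$ Then $Q_{0,0}(x_1,\ldots,x_5,y_1,\ldots,y_{14})=1$; $Q_{n,i}(x_1,\ldots,x_5,y_1,\ldots,y_{14})=0$ for $i<0$ or $i>\binom n2$; and for $n\ge 1$ and $0\le i\le\binom n2$, $$\begin{aligned} &Q_{n,i}(x_1,\ldots,x_5,y_1,\ldots,y_{14})\\ &=\sum_{k=1}^{n}\sum_{j=0}^{i+1-k} x_1^{\,j}\;x_2^{\binom{k-1}{2}-j}\;x_3^{(n-k)(k+j-1)}\;x_4^{k(i+1-k-j)}\;x_5^{(n-k)\left(\binom{k-1}{2}-j\right)+k\left(\binom{n-k}{2}+k+j-i-1\right)}\\ &\quad\cdot y_4^{j(n-k)}\;y_7^{\left(\binom{k-1}{2}-j\right)(n-k)}\;y_8^{(j+k-1)(i+1-k-j)}\;y_9^{(j+k-1)\left(\binom{n-k}{2}+k+j-i-1\right)}\\ &\quad\cdot y_{13}^{\left(\binom{k-1}{2}-j\right)(i+1-k-j)}\;y_{14}^{\left(\binom{k-1}{2}-j\right)\left(\binom{n-k}{2}+k+j-i-1\right)}\\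 &\quad\cdot Q_{k-1,\,j}\!\left(x_1y_1y_4^{n-k},\,x_2y_2y_7^{n-k},\,x_3y_3y_9^{n-k},\,x_4y_5y_{12}^{n-k},\,x_5y_6y_{14}^{n-k},\,y_1,\ldots,y_{14}\right)\\ &\quad\cdot Q_{n-k,\,i+1-k-j}\!\left(x_1y_{10}^{k},\,x_2y_{11}^{k},\,x_3y_{12}^{k},\,x_4y_{13}^{k},\,x_5y_{14}^{k},\,y_1,\ldots,y_{14}\right). \end{aligned}$$
   Context: $\mathcal{S}_n$ is the set of permutations of $\{1,\ldots,n\}$ in one-line notation ($\mathcal{S}_0$ consists of the empty permutation). For a sequence $w$ of distinct integers, $\mathrm{red}(w)$ is the permutation obtained by replacing the $i$-th smallest entry of $w$ by $i$. For $\tau\in\mathcal{S}_j$ and $\sigma=\sigma_1\cdots\sigma_n\in\mathcal{S}_n$, $\mathrm{occr}_\tau(\sigma)$ is the number of index sets $1\le i_1<\cdots<i_j\le n$ with $\mathrm{red}(\sigma_{i_1}\cdots\sigma_{i_j})=\tau$. $\mathcal{S}_n(132)$ is the set of $\sigma\in\mathcal{S}_n$ with $\mathrm{occr}_{132}(\sigma)=0$. An inner sum with $i+1-k<0$ is empty. The identities are between Laurent polynomials in the variables; terms in which a factor $Q_{k-1,j}$ or $Q_{n-k,i+1-k-j}$ vanishes are zero (regardless of possibly negative exponents). *)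

theory Defs
  imports
    Main
    "HOL-Library.Poly_Mapping"
    "HOL-Combinatorics.Multiset_Permutations"
begin

(* The permutations of {1..n} in one-line notation are the lists in permutations_of_set {1..n}. *)

definition red :: "nat list \<Rightarrow> nat list" where
  "red w = map (\<lambda>v. card {u \<in> set w. u \<le> v}) w"

(* Positions are counted from 0; nths \<sigma> I is the subsequence of \<sigma> at the positions in I. *)
definition occr :: "nat list \<Rightarrow> nat list \<Rightarrow> nat" where
  "occr \<tau> \<sigma> = card {I. I \<subseteq> {..<length \<sigma>} \<and> card I = length \<tau> \<and> red (nths \<sigma> I) = \<tau>}"

definition S132 :: "nat \<Rightarrow> nat list set" where
  "S132 n = {\<sigma> \<in> permutations_of_set {1..n}. occr [1,3,2] \<sigma> = 0}"

definition alphas :: "nat list list" where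
  "alphas = [[1,2,3], [2,1,3], [2,3,1], [3,1,2], [3,2,1]]"

definition betas :: "nat list list" where
  "betas = [[1,2,3,4], [2,1,3,4], [2,3,1,4], [2,3,4,1], [3,1,2,4], [3,2,1,4], [3,2,4,1],
            [3,4,1,2], [3,4,2,1], [4,1,2,3], [4,2,1,3], [4,2,3,1], [4,3,1,2], [4,3,2,1]]"

(* The lists xs and ys hold the 5 and 14 arguments; the a-th argument (a = 1, 2, ...) is
   the list entry with index a - 1.  The arguments may come from any commutative semiring, so
   that the same function describes Q at the variables and at the substituted monomials. *)
definition Q :: "nat \<Rightarrow> int \<Rightarrow> 'a::comm_semiring_1 list \<Rightarrow> 'a list \<Rightarrow> 'a" where
  "Q n i xs ys =
     (\<Sum>\<sigma> \<in> {\<sigma> \<in> S132 n. int (occr [1,2] \<sigma>) = i}.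
        (\<Prod>a<5. (xs ! a) ^ occr (alphas ! a) \<sigma>) *
        (\<Prod>b<14. (ys ! b) ^ occr (betas ! b) \<sigma>))"

(* Laurent polynomials with integer coefficients: finitely supported functions on the
   exponent vectors (finitely supported functions from variables to int), with the
   convolution product.  Only XV 1, ..., XV 5 and YV 1, ..., YV 14 are used. *)
datatype var = XV nat | YV nat

type_synonym laurent = "(var \<Rightarrow>\<^sub>0 int) \<Rightarrow>\<^sub>0 int"

(* the Laurent monomials x_a^e and y_b^e with an arbitrary integer exponent e *)
definition xpow :: "nat \<Rightarrow> int \<Rightarrow> laurent" where
  "xpow a e = Poly_Mapping.single (Poly_Mapping.single (XV a) e) 1"

definition ypow :: "nat \<Rightarrow> int \<Rightarrow> laurent" where
  "ypow b e = Poly_Mapping.single (Poly_Mapping.single (YV b) e) 1"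

abbreviation X :: "nat \<Rightarrow> laurent" where
  "X a \<equiv> xpow a 1"

abbreviation Y :: "nat \<Rightarrow> laurent" where
  "Y b \<equiv> ypow b 1"

definition xvars :: "laurent list" where
  "xvars = [X 1, X 2, X 3, X 4, X 5]"

definition yvars :: "laurent list" where
  "yvars = [Y 1, Y 2, Y 3, Y 4, Y 5, Y 6, Y 7, Y 8, Y 9, Y 10, Y 11, Y 12, Y 13, Y 14]"

(* The binomial coefficient (m choose 2) as an integer, since it enters exponents that
   involve genuine (non-truncated) subtraction. *)
abbreviation choose2 :: "nat \<Rightarrow> int" where
  "choose2 m \<equiv> int (m choose 2)"

end

theory Submission
  imports Defs "HOL-Library.Sublist"
begin

text \<open>A permutation avoiding 132 is \<open>L n R\<close> with \<open>n\<close> its maximum, every entry of \<open>L\<close> larger than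
  every entry of \<open>R\<close>, and \<open>L\<close>, \<open>R\<close> avoiding 132. An occurrence of a pattern \<open>\<tau>\<close> then cuts \<open>\<tau>\<close> into
  a prefix in \<open>L n\<close> and a suffix in \<open>R\<close>, the prefix lying above the suffix; if the prefix ends with
  its maximum, that entry may be \<open>n\<close>. Summing over the cuts writes each pattern count of \<open>L n R\<close>
  through counts of patterns of at most the same length in \<open>L\<close> and \<open>R\<close>. The terms linear in counts of
  patterns of length 3 become the substitutions in the arguments of \<open>Q\<close>; the remaining ones involve
  only the patterns 12 and 21 and become the monomial factor.\<close>

subsection \<open>Standardization and pattern counts\<close>

lemma length_red [simp]: "length (red w) = length w"
  by (simp add: red_def)

lemma red_pos: "x \<in> set (red w) \<Longrightarrow> 0 < x"
  by (auto simp: red_def card_gt_0_iff)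

lemma red_map_strict_mono:
  assumes "strict_mono f"
  shows "red (map f w) = red w"
proof -
  have "card {u \<in> f ` set w. u \<le> f v} = card {u \<in> set w. u \<le> v}" for v
  proof -
    have "{u \<in> f ` set w. u \<le> f v} = f ` {u \<in> set w. u \<le> v}"
      using assms by (auto simp: strict_mono_less_eq)
    then show ?thesis
      by (metis card_image strict_mono_imp_inj_on[OF assms])
  qed
  then show ?thesis
    by (simp add: red_def)
qed

text \<open>An entry of \<open>u\<close> ranks above all of \<open>v\<close>, which adds
  \<open>length v\<close> to its rank since \<open>v\<close> is distinct; an entry of
  \<open>v\<close> sees nothing of \<open>u\<close> below it.\<close>

lemma red_append_greater:
  assumes gt: "\<And>a b. a \<in> set u \<Longrightarrow> b \<in> set v \<Longrightarrow> b < a" and "distinct v"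
  shows "red (u @ v) = map (\<lambda>x. x + length v) (red u) @ red v"
proof -
  have "card {x \<in> set u \<union> set v. x \<le> a} = card {x \<in> set u. x \<le> a} + length v"
    if "a \<in> set u" for a
  proof -
    have "{x \<in> set u \<union> set v. x \<le> a} = {x \<in> set u. x \<le> a} \<union> set v"
      using gt[OF that] by fastforce
    moreover have "{x \<in> set u. x \<le> a} \<inter> set v = {}"
      using gt by fastforce
    ultimately show ?thesis
      by (simp add: card_Un_disjoint distinct_card[OF \<open>distinct v\<close>])
  qed
  moreover have "{x \<in> set u \<union> set v. x \<le> b} = {x \<in> set v. x \<le> b}" if "b \<in> set v" for b
    using gt that by fastforce
  ultimately show ?thesis
    by (simp add: red_def)
qed

lemma red_snoc_max:
  assumes less: "\<And>a. a \<in> set u \<Longrightarrow> a < m" and "distinct u"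
  shows "red (u @ [m]) = red u @ [Suc (length u)]"
proof -
  have "{x \<in> insert m (set u). x \<le> a} = {x \<in> set u. x \<le> a}" if "a \<in> set u" for a
    using less[OF that] by auto
  moreover have "{x \<in> insert m (set u). x \<le> m} = insert m (set u)"
    using less by force
  moreover have "card (insert m (set u)) = Suc (length u)"
    using less distinct_card[OF \<open>distinct u\<close>] by (subst card_insert_disjoint) auto
  ultimately show ?thesis
    by (simp add: red_def)
qed

text \<open>Only positions inside the list matter to \<open>nths\<close>. This justifies trimming
  index sets to the length of the list.\<close>

lemma nths_cong_set:
  "(\<And>i. i < length xs \<Longrightarrow> i \<in> A \<longleftrightarrow> i \<in> B) \<Longrightarrow> nths xs A = nths xs B"
proof (induction xs arbitrary: A B)
  case (Cons x xs)
  have "nths xs {j. Suc j \<in> A} = nths xs {j. Suc j \<in> B}"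
    using Cons.prems by (intro Cons.IH) auto
  then show ?case
    using Cons.prems[of 0] by (simp add: nths_Cons)
qed simp

lemma length_nths_subset: "I \<subseteq> {..<length xs} \<Longrightarrow> length (nths xs I) = card I"
  unfolding length_nths by (intro arg_cong[of _ _ card]) auto

text \<open>\<open>red\<close> preserves length, so equality with \<open>\<tau>\<close> forces the
  size of the index set.\<close>

lemma occr_eq_card:
  "occr \<tau> \<sigma> = card {I. I \<subseteq> {..<length \<sigma>} \<and> red (nths \<sigma> I) = \<tau>}"
proof -
  have "card I = length \<tau>" if "I \<subseteq> {..<length \<sigma>}" "red (nths \<sigma> I) = \<tau>" for I
    using length_nths_subset[OF that(1)] that(2) by auto
  then show ?thesis
    unfolding occr_def by (intro arg_cong[of _ _ card]) auto
qed

lemma finite_occr: "finite {I. I \<subseteq> {..<length \<sigma>} \<and> red (nths \<sigma> I) = \<tau>}"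
  by (rule finite_subset[of _ "Pow {..<length \<sigma>}"]) auto

lemma occr_pos:
  assumes "subseq w \<sigma>" and "red w = \<tau>"
  shows "0 < occr \<tau> \<sigma>"
proof -
  obtain N where "w = nths \<sigma> N"
    using assms(1) by (auto simp: subseq_conv_nths)
  \<comment> \<open>\<open>N\<close> may contain indices beyond the end of the list, whereas
    \<open>occr\<close> counts index sets inside it.\<close>
  moreover have "nths \<sigma> N = nths \<sigma> (N \<inter> {..<length \<sigma>})"
    by (rule nths_cong_set) auto
  ultimately have "N \<inter> {..<length \<sigma>} \<in> {I. I \<subseteq> {..<length \<sigma>} \<and> red (nths \<sigma> I) = \<tau>}"
    using assms(2) by auto
  then show ?thesis
    unfolding occr_eq_card using finite_occr[of \<sigma> \<tau>] card_gt_0_iff by blast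
qed

lemma occr_map_strict_mono: "strict_mono f \<Longrightarrow> occr \<tau> (map f \<sigma>) = occr \<tau> \<sigma>"
  by (simp add: occr_eq_card nths_map red_map_strict_mono)

lemma occr_Nil_left [simp]: "occr [] \<sigma> = 1"
proof -
  have "I \<subseteq> {..<length \<sigma>} \<and> card I = 0 \<and> red (nths \<sigma> I) = [] \<longleftrightarrow> I = {}" for I
    using finite_subset[of I "{..<length \<sigma>}"] by (auto simp: red_def)
  then show ?thesis
    by (simp add: occr_def)
qed

lemma occr_Nil_right: "\<tau> \<noteq> [] \<Longrightarrow> occr \<tau> [] = 0"
  by (simp add: occr_eq_card red_def)

section \<open>Pattern counts of concatenations\<close>

lemma occr_append:
  "occr \<tau> (A @ B) = card {(I, J). I \<subseteq> {..<length A} \<and> J \<subseteq> {..<length B} \<and>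
     red (nths A I @ nths B J) = \<tau>}"
  (is "_ = card ?P")
proof -
  \<comment> \<open>An index set of \<open>A @ B\<close> splits at \<open>length A\<close>;
    positions in \<open>B\<close> start again from 0, hence the shift.\<close>
  let ?f = "\<lambda>(I, J). I \<union> (\<lambda>j. j + length A) ` J"
  have eq: "nths (A @ B) (?f (I, J)) = nths A I @ nths B J" if "I \<subseteq> {..<length A}" for I J
  proof -
    have "nths A (?f (I, J)) = nths A I"
      by (rule nths_cong_set) auto
    moreover have "{j. j + length A \<in> ?f (I, J)} = J"
      using that by auto
    ultimately show ?thesis
      by (simp add: nths_append)
  qed
  have "bij_betw ?f ?P {I. I \<subseteq> {..<length (A @ B)} \<and> red (nths (A @ B) I) = \<tau>}"
  proof (rule bij_betw_byWitness[where f' = "\<lambda>K. (K \<inter> {..<length A}, {j. j + length A \<in> K})"])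
    show "\<forall>p\<in>?P. (?f p \<inter> {..<length A}, {j. j + length A \<in> ?f p}) = p"
      by auto
    show "\<forall>K\<in>{I. I \<subseteq> {..<length (A @ B)} \<and> red (nths (A @ B) I) = \<tau>}.
        ?f (K \<inter> {..<length A}, {j. j + length A \<in> K}) = K"
    proof -
      have "x \<in> (\<lambda>j. j + length A) ` {j. j + length A \<in> K}"
        if "x \<in> K" "\<not> x < length A" for x K
        using that by (intro image_eqI[of _ _ "x - length A"]) auto
      then show ?thesis
        by auto
    qed
    show "?f ` ?P \<subseteq> {I. I \<subseteq> {..<length (A @ B)} \<and> red (nths (A @ B) I) = \<tau>}"
      using eq by fastforce
    show "(\<lambda>K. (K \<inter> {..<length A}, {j. j + length A \<in> K})) `
        {I. I \<subseteq> {..<length (A @ B)} \<and> red (nths (A @ B) I) = \<tau>} \<subseteq> ?P"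
    proof -
      have "nths A (K \<inter> {..<length A}) = nths A K" for K
        by (rule nths_cong_set) auto
      then show ?thesis
        by (auto simp: nths_append)
    qed
  qed
  then show ?thesis
    by (simp add: occr_eq_card bij_betw_same_card)
qed

text \<open>Here \<open>s\<close> is the number of letters of an occurrence lying in
  \<open>A\<close>. As \<open>A\<close> lies above \<open>B\<close>, the first \<open>s\<close>
  letters of the pattern must be its largest ones, and subtracting \<open>length \<tau> - s\<close>
  standardizes them. The two blocks are then filled independently, hence the product.\<close>

lemma occr_append_greater:
  assumes gt: "\<And>a b. a \<in> set A \<Longrightarrow> b \<in> set B \<Longrightarrow> b < a" and "distinct B"
  shows "occr \<tau> (A @ B) = (\<Sum>s\<le>length \<tau>.
    if \<forall>x\<in>set (take s \<tau>). length \<tau> - s < x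
    then occr (map (\<lambda>x. x - (length \<tau> - s)) (take s \<tau>)) A * occr (drop s \<tau>) B else 0)"
  (is "_ = (\<Sum>s\<le>_. ?h s)")
proof -
  define P where "P s = {(I, J). I \<subseteq> {..<length A} \<and> J \<subseteq> {..<length B} \<and>
    length (nths A I) = s \<and> red (nths A I @ nths B J) = \<tau>}" for s
  have fin: "finite (P s)" for s
    by (rule finite_subset[of _ "Pow {..<length A} \<times> Pow {..<length B}"]) (auto simp: P_def)
  have red_eq: "red (nths A I @ nths B J) =
      map (\<lambda>x. x + length (nths B J)) (red (nths A I)) @ red (nths B J)" for I J
    using gt \<open>distinct B\<close> by (intro red_append_greater) (auto dest: in_set_nthsD)
  have split: "length (nths A I) = s \<and> red (nths A I @ nths B J) = \<tau> \<longleftrightarrow>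
      (\<forall>x\<in>set (take s \<tau>). length \<tau> - s < x) \<and>
      red (nths A I) = map (\<lambda>x. x - (length \<tau> - s)) (take s \<tau>) \<and>
      red (nths B J) = drop s \<tau>" (is "?l \<longleftrightarrow> ?r") if "s \<le> length \<tau>" for s I J
  proof
    assume ?l
    then have \<tau>: "\<tau> = map (\<lambda>x. x + length (nths B J)) (red (nths A I)) @ red (nths B J)"
      and s: "s = length (nths A I)"
      by (auto simp: red_eq)
    then have "take s \<tau> = map (\<lambda>x. x + length (nths B J)) (red (nths A I))"
      "length \<tau> - s = length (nths B J)" "drop s \<tau> = red (nths B J)"
      by auto
    \<comment> \<open>Entries of a reduced word are positive, so after the shift they exceed
      \<open>length \<tau> - s\<close>.\<close>
    then show ?r
      by (auto simp: o_def dest: red_pos)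
  next
    assume r: ?r
    then have "length (red (nths A I)) = s" "length (red (nths B J)) = length \<tau> - s"
      using that by auto
    then have len: "length (nths A I) = s" "length (nths B J) = length \<tau> - s"
      by simp_all
    \<comment> \<open>The addition undoes the truncated subtraction because every entry of the
      prefix exceeds \<open>length \<tau> - s\<close>.\<close>
    have "map ((\<lambda>x. x + (length \<tau> - s)) \<circ> (\<lambda>x. x - (length \<tau> - s))) (take s \<tau>) = take s \<tau>"
      using r by (intro map_idI) fastforce
    then show ?l
      using r len by (simp add: red_eq)
  qed
  have "card (P s) = ?h s" if "s \<le> length \<tau>" for s
  proof (cases "\<forall>x\<in>set (take s \<tau>). length \<tau> - s < x")
    case True
    then have "P s = {I. I \<subseteq> {..<length A} \<and>
          red (nths A I) = map (\<lambda>x. x - (length \<tau> - s)) (take s \<tau>)} \<times>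
        {J. J \<subseteq> {..<length B} \<and> red (nths B J) = drop s \<tau>}"
      unfolding P_def split[OF that] by auto
    then show ?thesis
      using True by (simp add: card_cartesian_product occr_eq_card)
  next
    case False
    then have "P s = {}"
      unfolding P_def split[OF that] by auto
    then show ?thesis
      by (simp add: False)
  qed
  moreover have "{(I, J). I \<subseteq> {..<length A} \<and> J \<subseteq> {..<length B} \<and>
      red (nths A I @ nths B J) = \<tau>} = (\<Union>s\<le>length \<tau>. P s)"
    by (auto simp: P_def red_eq)
  then have "occr \<tau> (A @ B) = (\<Sum>s\<le>length \<tau>. card (P s))"
    by (simp only: occr_append) (subst card_UN_disjoint, auto simp: fin, auto simp: P_def)
  ultimately show ?thesis
    by simp
qed

text \<open>An occurrence either misses \<open>m\<close> or uses it as its last and largest letter.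
  In the second case the pattern ends in its own length and its other letters occur in
  \<open>A\<close>.\<close>

lemma occr_snoc_max:
  assumes less: "\<And>a. a \<in> set A \<Longrightarrow> a < m" and "distinct A"
  shows "occr \<tau> (A @ [m]) = occr \<tau> A +
    (if \<tau> \<noteq> [] \<and> last \<tau> = length \<tau> then occr (butlast \<tau>) A else 0)"
proof -
  let ?R = "\<lambda>\<rho>. {I. I \<subseteq> {..<length A} \<and> red (nths A I) = \<rho>}"
  have red_eq: "red (nths A I @ [m]) = \<tau> \<longleftrightarrow>
      red (nths A I) = butlast \<tau> \<and> \<tau> \<noteq> [] \<and> last \<tau> = length \<tau>" for I \<tau>
  proof -
    have "red (nths A I @ [m]) = red (nths A I) @ [Suc (length (nths A I))]"
      using less \<open>distinct A\<close> by (intro red_snoc_max) (auto dest: in_set_nthsD)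
    then have "red (nths A I @ [m]) = \<tau> \<longleftrightarrow>
        red (nths A I) @ [Suc (length (red (nths A I)))] = \<tau>"
      by simp
    also have "\<dots> \<longleftrightarrow> red (nths A I) = butlast \<tau> \<and> \<tau> \<noteq> [] \<and> last \<tau> = length \<tau>"
      by (cases \<tau> rule: rev_cases) auto
    finally show ?thesis .
  qed
  have sub: "J \<subseteq> {..<Suc 0} \<longleftrightarrow> J = {} \<or> J = {0}" for J
    by (auto simp: lessThan_Suc)
  have "{(I, J). I \<subseteq> {..<length A} \<and> J \<subseteq> {..<length [m]} \<and> red (nths A I @ nths [m] J) = \<tau>} =
      ?R \<tau> \<times> {{}} \<union> (if \<tau> \<noteq> [] \<and> last \<tau> = length \<tau> then ?R (butlast \<tau>) else {}) \<times> {{0}}"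
    by (auto simp: sub red_eq split: if_splits)
  then show ?thesis
    unfolding occr_append
    by (simp only:) (subst card_Un_disjoint, auto simp: finite_occr card_cartesian_product occr_eq_card)
qed

section \<open>Patterns of length one and two\<close>

lemma occr_singleton: "distinct \<sigma> \<Longrightarrow> occr [1] \<sigma> = length \<sigma>"
proof -
  have *: "red (nths \<sigma> I) = [1]" if "I \<subseteq> {..<length \<sigma>}" "card I = 1" for I
  proof -
    have "length (nths \<sigma> I) = 1"
      using that by (simp add: length_nths_subset)
    then obtain a where a: "nths \<sigma> I = [a]"
      by (auto simp: length_Suc_conv)
    have "{u. u = a \<and> u \<le> a} = {a}"
      by auto
    then show ?thesis
      by (simp add: a red_def)
  qed
  then have "occr [1] \<sigma> = card {I. I \<subseteq> {..<length \<sigma>} \<and> card I = 1}"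
    unfolding occr_def by (intro arg_cong[of _ _ card]) auto
  then show ?thesis
    by (simp add: n_subsets)
qed

lemma red_pair: "a \<noteq> b \<Longrightarrow> red [a, b] = (if a < b then [1, 2] else [2, 1])"
proof -
  assume "a \<noteq> b"
  then have "{u. (u = a \<or> u = b) \<and> u \<le> a} = (if a < b then {a} else {a, b})"
    "{u. (u = a \<or> u = b) \<and> u \<le> b} = (if a < b then {a, b} else {b})"
    by auto
  then show ?thesis
    using \<open>a \<noteq> b\<close> by (simp add: red_def)
qed

text \<open>A pair of positions carries distinct values, hence exactly one of the two patterns. This
  identifies the differences from \<open>choose2\<close> in the recurrence as inversion
  counts.\<close>

lemma occr_12_add_21:
  assumes "distinct \<sigma>"
  shows "occr [1, 2] \<sigma> + occr [2, 1] \<sigma> = length \<sigma> choose 2"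
proof -
  let ?S = "\<lambda>\<tau>. {I. I \<subseteq> {..<length \<sigma>} \<and> card I = 2 \<and> red (nths \<sigma> I) = \<tau>}"
  have "red (nths \<sigma> I) \<in> {[1, 2], [2, 1]}" if "I \<subseteq> {..<length \<sigma>}" "card I = 2" for I
  proof -
    have "length (nths \<sigma> I) = 2"
      using that by (simp add: length_nths_subset)
    then obtain a b where ab: "nths \<sigma> I = [a, b]"
      by (auto simp: length_Suc_conv numeral_2_eq_2)
    then have "a \<noteq> b"
      using distinct_nthsI[OF assms, of I] by simp
    then show ?thesis
      by (simp add: ab red_pair)
  qed
  then have "{I. I \<subseteq> {..<length \<sigma>} \<and> card I = 2} = ?S [1, 2] \<union> ?S [2, 1]"
    by auto
  moreover have "finite (?S \<tau>)" for \<tau>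
    by (rule finite_subset[of _ "Pow {..<length \<sigma>}"]) auto
  moreover have "?S [1, 2] \<inter> ?S [2, 1] = {}"
    by auto
  ultimately have "card {I. I \<subseteq> {..<length \<sigma>} \<and> card I = 2} = card (?S [1, 2]) + card (?S [2, 1])"
    by (simp add: card_Un_disjoint)
  then show ?thesis
    by (simp add: n_subsets occr_def numeral_2_eq_2)
qed

subsection \<open>Splitting a permutation at its maximum\<close>

text \<open>The bracketing groups the maximum with the raised left block, so that everything before
  \<open>R\<close> exceeds everything in it and \<open>occr_append_greater\<close> applies.\<close>

definition join :: "nat list \<Rightarrow> nat list \<Rightarrow> nat list" where
  "join L R = (map (\<lambda>x. x + length R) L @ [Suc (length L + length R)]) @ R"

lemma perm_atLeastAtMostD:
  assumes "\<sigma> \<in> permutations_of_set {1..n}"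
  shows "distinct \<sigma>" "set \<sigma> = {1..n}" "length \<sigma> = n"
  using assms length_finite_permutations_of_set[of \<sigma> "{1..n}"] by (auto simp: permutations_of_set_def)

lemma join_permutations_of_set:
  assumes "L \<in> permutations_of_set {1..m}" "R \<in> permutations_of_set {1..r}"
  shows "join L R \<in> permutations_of_set {1..Suc (m + r)}"
proof -
  have "set (join L R) = (\<lambda>x. x + r) ` {1..m} \<union> {Suc (m + r)} \<union> {1..r}"
    using perm_atLeastAtMostD[OF assms(1)] perm_atLeastAtMostD[OF assms(2)] by (auto simp: join_def)
  also have "(\<lambda>x. x + r) ` {1..m} = {1 + r..m + r}"
    by (rule image_add_atLeastAtMost')
  also have "{1 + r..m + r} \<union> {Suc (m + r)} \<union> {1..r} = {1..Suc (m + r)}"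
    by auto
  finally have "set (join L R) = {1..Suc (m + r)}" .
  moreover have "distinct (join L R)"
    using perm_atLeastAtMostD[OF assms(1)] perm_atLeastAtMostD[OF assms(2)]
    by (auto simp: join_def distinct_map)
  ultimately show ?thesis
    by (auto simp: permutations_of_set_def)
qed

text \<open>Cut first before \<open>R\<close>, then before the maximum. Raising \<open>L\<close> is
  strictly monotone and hence invisible to \<open>occr\<close>.\<close>

lemma occr_join:
  assumes "L \<in> permutations_of_set {1..m}" "R \<in> permutations_of_set {1..r}"
  shows "occr \<tau> (join L R) = (\<Sum>s\<le>length \<tau>.
    if \<forall>x\<in>set (take s \<tau>). length \<tau> - s < x
    then (let t = map (\<lambda>x. x - (length \<tau> - s)) (take s \<tau>) in
      occr t L + (if t \<noteq> [] \<and> last t = length t then occr (butlast t) L else 0)) *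
      occr (drop s \<tau>) R else 0)"
proof -
  note L = perm_atLeastAtMostD[OF assms(1)] and R = perm_atLeastAtMostD[OF assms(2)]
  have "occr \<tau> (join L R) = (\<Sum>s\<le>length \<tau>.
      if \<forall>x\<in>set (take s \<tau>). length \<tau> - s < x
      then occr (map (\<lambda>x. x - (length \<tau> - s)) (take s \<tau>))
        (map (\<lambda>x. x + length R) L @ [Suc (length L + length R)]) * occr (drop s \<tau>) R else 0)"
    unfolding join_def using L R by (intro occr_append_greater) auto
  moreover have "occr t (map (\<lambda>x. x + length R) L @ [Suc (length L + length R)]) =
      occr t L + (if t \<noteq> [] \<and> last t = length t then occr (butlast t) L else 0)" for t
  proof -
    have "strict_mono (\<lambda>x. x + length R)"
      by (simp add: strict_mono_def)
    moreover have "occr t (map (\<lambda>x. x + length R) L @ [Suc (length L + length R)]) =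
      occr t (map (\<lambda>x. x + length R) L) +
      (if t \<noteq> [] \<and> last t = length t then occr (butlast t) (map (\<lambda>x. x + length R) L) else 0)"
      using L by (intro occr_snoc_max) (auto simp: distinct_map)
    ultimately show ?thesis
      by (simp only: occr_map_strict_mono)
  qed
  ultimately show ?thesis
    by (simp only: Let_def)
qed

text \<open>\<open>Suc 0\<close> is the simplifier's normal form of \<open>1\<close>, so the rule
  fires in the evaluations that follow.\<close>

lemma occr_1_permutation: "\<sigma> \<in> permutations_of_set {1..n} \<Longrightarrow> occr [Suc 0] \<sigma> = n"
  using occr_singleton [of \<sigma>] perm_atLeastAtMostD [of \<sigma> n] by simp

text \<open>Each equation evaluates \<open>occr_join\<close> at a concrete pattern, where only the
  cuts with prefix above suffix survive. A prefix of one letter contributes \<open>Suc m\<close>,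
  the maximum included; a prefix of type 12 contributes \<open>occr [1,2] L + m\<close>, its top
  letter being possibly the maximum. The pattern 132 has no proper cut and does not end in its
  maximum, so its counts simply add up.\<close>

lemma occr_join_patterns:
  assumes "L \<in> permutations_of_set {1..m}" "R \<in> permutations_of_set {1..r}"
  shows "occr [1,3,2] (join L R) = occr [1,3,2] L + occr [1,3,2] R"
    and "occr [1,2] (join L R) = occr [1,2] L + m + occr [1,2] R"
    and "occr [1,2,3] (join L R) = occr [1,2,3] L + occr [1,2] L + occr [1,2,3] R"
    and "occr [2,1,3] (join L R) = occr [2,1,3] L + occr [2,1] L + occr [2,1,3] R"
    and "occr [2,3,1] (join L R) = occr [2,3,1] L + (occr [1,2] L + m) * r + occr [2,3,1] R"
    and "occr [3,1,2] (join L R) = occr [3,1,2] L + Suc m * occr [1,2] R + occr [3,1,2] R"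
    and "occr [3,2,1] (join L R) =
      occr [3,2,1] L + occr [2,1] L * r + Suc m * occr [2,1] R + occr [3,2,1] R"
    and "occr [1,2,3,4] (join L R) = occr [1,2,3,4] L + occr [1,2,3] L + occr [1,2,3,4] R"
    and "occr [2,1,3,4] (join L R) = occr [2,1,3,4] L + occr [2,1,3] L + occr [2,1,3,4] R"
    and "occr [2,3,1,4] (join L R) = occr [2,3,1,4] L + occr [2,3,1] L + occr [2,3,1,4] R"
    and "occr [2,3,4,1] (join L R) =
      occr [2,3,4,1] L + (occr [1,2,3] L + occr [1,2] L) * r + occr [2,3,4,1] R"
    and "occr [3,1,2,4] (join L R) = occr [3,1,2,4] L + occr [3,1,2] L + occr [3,1,2,4] R"
    and "occr [3,2,1,4] (join L R) = occr [3,2,1,4] L + occr [3,2,1] L + occr [3,2,1,4] R"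
    and "occr [3,2,4,1] (join L R) =
      occr [3,2,4,1] L + (occr [2,1,3] L + occr [2,1] L) * r + occr [3,2,4,1] R"
    and "occr [3,4,1,2] (join L R) =
      occr [3,4,1,2] L + (occr [1,2] L + m) * occr [1,2] R + occr [3,4,1,2] R"
    and "occr [3,4,2,1] (join L R) =
      occr [3,4,2,1] L + occr [2,3,1] L * r + (occr [1,2] L + m) * occr [2,1] R + occr [3,4,2,1] R"
    and "occr [4,1,2,3] (join L R) = occr [4,1,2,3] L + Suc m * occr [1,2,3] R + occr [4,1,2,3] R"
    and "occr [4,2,1,3] (join L R) = occr [4,2,1,3] L + Suc m * occr [2,1,3] R + occr [4,2,1,3] R"
    and "occr [4,2,3,1] (join L R) =
      occr [4,2,3,1] L + occr [3,1,2] L * r + Suc m * occr [2,3,1] R + occr [4,2,3,1] R"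
    and "occr [4,3,1,2] (join L R) =
      occr [4,3,1,2] L + occr [2,1] L * occr [1,2] R + Suc m * occr [3,1,2] R + occr [4,3,1,2] R"
    and "occr [4,3,2,1] (join L R) =
      occr [4,3,2,1] L + occr [3,2,1] L * r + occr [2,1] L * occr [2,1] R +
      Suc m * occr [3,2,1] R + occr [4,3,2,1] R"
  by (simp_all add: occr_join[OF assms] occr_1_permutation[OF assms(1)]
      occr_1_permutation[OF assms(2)] atMost_Suc Let_def)

section \<open>132-avoiding permutations as joins\<close>

lemma red_132: "a < b \<Longrightarrow> b < c \<Longrightarrow> red [a, c, b] = [1, 3, 2]"
proof -
  assume "a < b" "b < c"
  then have "{u. (u = a \<or> u = c \<or> u = b) \<and> u \<le> a} = {a}"
    "{u. (u = a \<or> u = c \<or> u = b) \<and> u \<le> b} = {a, b}"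
    "{u. (u = a \<or> u = c \<or> u = b) \<and> u \<le> c} = {a, b, c}"
    by auto
  then show ?thesis
    using \<open>a < b\<close> \<open>b < c\<close> by (simp add: red_def)
qed

text \<open>Cut at the maximum \<open>n\<close>. Avoidance of 132 puts all values left of
  \<open>n\<close> above those right of it, so the right part is a permutation of an initial segment
  and the left part one after a shift.\<close>

lemma S132_split:
  assumes "\<sigma> \<in> S132 n" "1 \<le> n"
  obtains k L R where "k \<in> {1..n}" "L \<in> S132 (k - 1)" "R \<in> S132 (n - k)" "\<sigma> = join L R"
proof -
  have perm: "\<sigma> \<in> permutations_of_set {1..n}" and av: "occr [1,3,2] \<sigma> = 0"
    using assms(1) by (auto simp: S132_def)
  note \<sigma> = perm_atLeastAtMostD[OF perm]
  have "n \<in> set \<sigma>"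
    using \<sigma>(2) assms(2) by simp
  then obtain A R where AR: "\<sigma> = A @ n # R"
    by (meson split_list)
  define r where "r = length R"
  have dist: "distinct A" "distinct R" "set A \<inter> set R = {}" "n \<notin> set A" "n \<notin> set R"
    using \<sigma>(1) AR by auto
  have union: "set A \<union> set R = {1..n - 1}"
  proof -
    have "set A \<union> set R = {1..n} - {n}"
      using \<sigma>(2) dist(4,5) unfolding AR by force
    also have "\<dots> = {1..n - 1}"
      by auto
    finally show ?thesis .
  qed
  \<comment> \<open>Otherwise \<open>a\<close>, \<open>n\<close>, \<open>b\<close> would form an
    occurrence of 132.\<close>
  have gt: "b < a" if "a \<in> set A" "b \<in> set R" for a b
  proof (rule ccontr)
    assume "\<not> b < a"
    then have "a < b"
      using that dist(3) by (metis disjoint_iff linorder_neqE_nat)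
    moreover have "b \<in> {1..n - 1}"
      using that(2) union by blast
    then have "b < n"
      by auto
    moreover have "subseq ([a] @ [n] @ [b]) (A @ [n] @ R)"
      using that by (intro list_emb_append_mono) (auto simp: subseq_singleton_left)
    ultimately have "0 < occr [1,3,2] \<sigma>"
      by (intro occr_pos[of "[a, n, b]"]) (auto simp: AR red_132)
    then show False
      using av by simp
  qed
  have R_eq: "set R = {1..r}"
  proof (cases "R = []")
    case False
    \<comment> \<open>The values of \<open>R\<close> are closed downwards: a value up to
      \<open>M\<close> cannot lie in \<open>A\<close>, whose entries all exceed \<open>M\<close>.
      Distinctness then gives \<open>M = r\<close>.\<close>
    define M where "M = Max (set R)"
    have "M \<in> set R"
      using False by (simp add: M_def)
    have "set R = {1..M}"
    proof
      show "set R \<subseteq> {1..M}"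
        using union by (auto simp: M_def)
      show "{1..M} \<subseteq> set R"
      proof
        fix x assume x: "x \<in> {1..M}"
        have "M \<in> {1..n - 1}"
          using \<open>M \<in> set R\<close> union by blast
        then have "x \<in> set A \<union> set R"
          using x unfolding union by auto
        moreover have "x \<notin> set A"
          using gt[OF _ \<open>M \<in> set R\<close>] x by force
        ultimately show "x \<in> set R"
          by blast
      qed
    qed
    then show ?thesis
      using distinct_card[OF dist(2)] by (simp add: r_def)
  qed (simp add: r_def)
  have n: "n = Suc (length A + r)"
    using \<sigma>(3) AR by (auto simp: r_def)
  have "set A = {1..n - 1} - {1..r}"
    using union dist(3) unfolding R_eq by blast
  also have "\<dots> = {Suc r..n - 1}"
    by auto
  finally have A_eq: "set A = {Suc r..n - 1}" .
  \<comment> \<open>All entries of \<open>A\<close> exceed \<open>r\<close>, so the truncated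
    subtraction is reversible.\<close>
  define L where "L = map (\<lambda>x. x - r) A"
  have shift: "map (\<lambda>x. x + r) L = A"
    using A_eq by (auto simp: L_def o_def intro!: map_idI)
  have \<sigma>_eq: "\<sigma> = join L R"
    using shift n by (simp add: join_def AR r_def) (simp add: L_def)
  have "set L = (\<lambda>x. x - r) ` {Suc r..n - 1}"
    by (simp add: L_def A_eq)
  also have "\<dots> = {1..length A}"
  proof
    show "{1..length A} \<subseteq> (\<lambda>x. x - r) ` {Suc r..n - 1}"
    proof
      fix x assume "x \<in> {1..length A}"
      then show "x \<in> (\<lambda>x. x - r) ` {Suc r..n - 1}"
        using n by (intro image_eqI[of _ _ "x + r"]) auto
    qed
  qed (use n in auto)
  finally have "set L = {1..length A}" .
  moreover have "distinct L"
    using shift dist(1) by (metis distinct_map)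
  ultimately have L: "L \<in> permutations_of_set {1..length A}"
    by (simp add: permutations_of_set_def)
  have R: "R \<in> permutations_of_set {1..r}"
    using R_eq dist(2) by (simp add: permutations_of_set_def)
  \<comment> \<open>The counts of 132 in the two parts add up to 0.\<close>
  have "occr [1,3,2] L = 0" "occr [1,3,2] R = 0"
    using av occr_join_patterns(1)[OF L R] \<sigma>_eq by auto
  then have "L \<in> S132 (Suc (length A) - 1)" "R \<in> S132 (n - Suc (length A))"
    using L R n by (simp_all add: S132_def)
  then show thesis
    using \<sigma>_eq n by (intro that[of "Suc (length A)" L R]) auto
qed

text \<open>\<open>k\<close> is the position of the maximum, counted from 1.\<close>

lemma bij_betw_join_S132:
  assumes "1 \<le> n"
  shows "bij_betw (\<lambda>(k, L, R). join L R) (SIGMA k:{1..n}. S132 (k - 1) \<times> S132 (n - k)) (S132 n)"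
  (is "bij_betw ?f ?D _")
proof (rule bij_betw_imageI)
  have len: "length L = k - 1" "length R = n - k" "Suc (length L + length R) = n"
    "set L \<subseteq> {1..k - 1}" "set R \<subseteq> {1..n - k}"
    if "(k, L, R) \<in> ?D" for k L R
    using that perm_atLeastAtMostD[of L] perm_atLeastAtMostD[of R] by (auto simp: S132_def)
  show "inj_on ?f ?D"
  proof (rule inj_onI)
    fix p p' assume p: "p \<in> ?D" and p': "p' \<in> ?D" and eq: "?f p = ?f p'"
    obtain k L R k' L' R' where p_eq: "p = (k, L, R)" "p' = (k', L', R')"
      by (metis prod_cases3)
    note l = len[OF p[unfolded p_eq]] and l' = len[OF p'[unfolded p_eq]]
    have "map (\<lambda>x. x + length R) L @ n # R = map (\<lambda>x. x + length R') L' @ n # R'"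
      using eq l(3) l'(3) by (simp add: join_def p_eq)
    \<comment> \<open>\<open>n\<close> lies in neither block, so both decompositions cut the list at
      the same place.\<close>
    moreover have "n \<notin> set (map (\<lambda>x. x + length R) L)" "n \<notin> set R"
      using l assms by fastforce+
    ultimately have "map (\<lambda>x. x + length R) L = map (\<lambda>x. x + length R') L' \<and> R = R'"
      using append_Cons_eq_iff by metis
    moreover have "inj (\<lambda>x. x + length R)"
      by simp
    ultimately have "L = L'" and R: "R = R'"
      by (metis inj_map_eq_map)+
    \<comment> \<open>\<open>k\<close> is recovered from the length of \<open>L\<close>.\<close>
    then show "p = p'"
      using R l(1) l'(1) p p' by (auto simp: p_eq)
  qed
  show "?f ` ?D = S132 n"
  proof
    show "?f ` ?D \<subseteq> S132 n"
    proof clarify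
      fix k L R assume "k \<in> {1..n}" and "L \<in> S132 (k - 1)" "R \<in> S132 (n - k)"
      then have L: "L \<in> permutations_of_set {1..k - 1}" and R: "R \<in> permutations_of_set {1..n - k}"
        and av: "occr [1,3,2] L = 0" "occr [1,3,2] R = 0" and "Suc (k - 1 + (n - k)) = n"
        by (auto simp: S132_def)
      then show "join L R \<in> S132 n"
        using join_permutations_of_set[OF L R] occr_join_patterns(1)[OF L R] by (simp add: S132_def)
    qed
    show "S132 n \<subseteq> ?f ` ?D"
    proof
      fix \<sigma> assume "\<sigma> \<in> S132 n"
      then obtain k L R where "k \<in> {1..n}" "L \<in> S132 (k - 1)" "R \<in> S132 (n - k)" "\<sigma> = join L R"
        using assms by (rule S132_split)
      then show "\<sigma> \<in> ?f ` ?D"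
        by (intro image_eqI[of _ _ "(k, L, R)"]) auto
    qed
  qed
qed

subsection \<open>The generating function\<close>

definition weight :: "'a::comm_semiring_1 list \<Rightarrow> 'a list \<Rightarrow> nat list \<Rightarrow> 'a" where
  "weight xs ys \<sigma> = (\<Prod>a<5. (xs ! a) ^ occr (alphas ! a) \<sigma>) *
    (\<Prod>b<14. (ys ! b) ^ occr (betas ! b) \<sigma>)"

lemma finite_S132 [simp]: "finite (S132 n)"
  by (simp add: S132_def)

text \<open>With the condition inside the summand the index set is independent of \<open>i\<close>,
  so sums can be reindexed and exchanged freely.\<close>

lemma Q_eq_sum_weight:
  "Q n i xs ys = (\<Sum>\<sigma>\<in>S132 n. if int (occr [1,2] \<sigma>) = i then weight xs ys \<sigma> else 0)"
  by (simp only: Q_def weight_def sum.inter_filter[OF finite_S132])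

lemma weight_expand:
  "weight [x1, x2, x3, x4, x5] [y1, y2, y3, y4, y5, y6, y7, y8, y9, y10, y11, y12, y13, y14] \<sigma> =
    x1 ^ occr [1,2,3] \<sigma> * x2 ^ occr [2,1,3] \<sigma> * x3 ^ occr [2,3,1] \<sigma> *
    x4 ^ occr [3,1,2] \<sigma> * x5 ^ occr [3,2,1] \<sigma> *
    y1 ^ occr [1,2,3,4] \<sigma> * y2 ^ occr [2,1,3,4] \<sigma> * y3 ^ occr [2,3,1,4] \<sigma> *
    y4 ^ occr [2,3,4,1] \<sigma> * y5 ^ occr [3,1,2,4] \<sigma> * y6 ^ occr [3,2,1,4] \<sigma> *
    y7 ^ occr [3,2,4,1] \<sigma> * y8 ^ occr [3,4,1,2] \<sigma> * y9 ^ occr [3,4,2,1] \<sigma> *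
    y10 ^ occr [4,1,2,3] \<sigma> * y11 ^ occr [4,2,1,3] \<sigma> * y12 ^ occr [4,2,3,1] \<sigma> *
    y13 ^ occr [4,3,1,2] \<sigma> * y14 ^ occr [4,3,2,1] \<sigma>"
  by (simp add: weight_def alphas_def betas_def lessThan_nat_numeral lessThan_Suc mult_ac)

text \<open>Collects exponents. A count of a length-3 pattern in \<open>L\<close> enters exponents
  of the \<open>y\<close> variables with coefficient 1 or \<open>r\<close>, one in \<open>R\<close>
  with coefficient \<open>Suc m\<close>; these are absorbed into the substituted arguments.\<close>

lemma weight_join:
  fixes x1 x2 x3 x4 x5 y1 y2 y3 y4 y5 y6 y7 y8 y9 y10 y11 y12 y13 y14 :: "'a::comm_semiring_1"
  assumes "L \<in> permutations_of_set {1..m}" "R \<in> permutations_of_set {1..r}"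
  defines "ys \<equiv> [y1, y2, y3, y4, y5, y6, y7, y8, y9, y10, y11, y12, y13, y14]"
  shows "weight [x1, x2, x3, x4, x5] ys (join L R) =
    x1 ^ occr [1,2] L * x2 ^ occr [2,1] L *
    x3 ^ (r * (m + occr [1,2] L)) * x4 ^ (Suc m * occr [1,2] R) *
    x5 ^ (r * occr [2,1] L + Suc m * occr [2,1] R) *
    y4 ^ (occr [1,2] L * r) * y7 ^ (occr [2,1] L * r) *
    y8 ^ ((occr [1,2] L + m) * occr [1,2] R) * y9 ^ ((occr [1,2] L + m) * occr [2,1] R) *
    y13 ^ (occr [2,1] L * occr [1,2] R) * y14 ^ (occr [2,1] L * occr [2,1] R) *
    weight [x1 * y1 * y4 ^ r, x2 * y2 * y7 ^ r, x3 * y3 * y9 ^ r, x4 * y5 * y12 ^ r,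
      x5 * y6 * y14 ^ r] ys L *
    weight [x1 * y10 ^ Suc m, x2 * y11 ^ Suc m, x3 * y12 ^ Suc m, x4 * y13 ^ Suc m,
      x5 * y14 ^ Suc m] ys R"
  unfolding ys_def weight_expand occr_join_patterns[OF assms(1,2)]
  by (simp only: power_add power_mult_distrib power_mult [symmetric] add_mult_distrib
      add_mult_distrib2 mult_ac)

section \<open>Laurent monomials and the weight of a join\<close>

lemma xpow_of_nat: "xpow a (int e) = X a ^ e"
proof (induction e)
  case 0
  then show ?case
    by (simp add: xpow_def)
next
  case (Suc e)
  have "xpow a (int (Suc e)) = X a * xpow a (int e)"
    by (simp add: xpow_def mult_single single_add [symmetric])
  then show ?case
    by (simp add: Suc.IH)
qed

lemma ypow_of_nat: "ypow b (int e) = Y b ^ e"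
proof (induction e)
  case 0
  then show ?case
    by (simp add: ypow_def)
next
  case (Suc e)
  have "ypow b (int (Suc e)) = Y b * ypow b (int e)"
    by (simp add: ypow_def mult_single single_add [symmetric])
  then show ?case
    by (simp add: Suc.IH)
qed

text \<open>For \<open>i\<close>, \<open>j\<close> the numbers of non-inversions of the whole and of the left part, the differences
  \<open>choose2 (k - 1) - j\<close> and \<open>choose2 (n - k) + k + j - i - 1\<close> are the numbers of inversions of
  the two parts.\<close>

definition join_factor :: "nat \<Rightarrow> nat \<Rightarrow> int \<Rightarrow> int \<Rightarrow> laurent" where
  "join_factor n k i j =
             xpow 1 j *
             xpow 2 (choose2 (k - 1) - j) *
             xpow 3 (int (n - k) * (int k + j - 1)) *
             xpow 4 (int k * (i + 1 - int k - j)) *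
             xpow 5 (int (n - k) * (choose2 (k - 1) - j)
                     + int k * (choose2 (n - k) + int k + j - i - 1)) *
             ypow 4 (j * int (n - k)) *
             ypow 7 ((choose2 (k - 1) - j) * int (n - k)) *
             ypow 8 ((j + int k - 1) * (i + 1 - int k - j)) *
             ypow 9 ((j + int k - 1) * (choose2 (n - k) + int k + j - i - 1)) *
             ypow 13 ((choose2 (k - 1) - j) * (i + 1 - int k - j)) *
             ypow 14 ((choose2 (k - 1) - j) * (choose2 (n - k) + int k + j - i - 1))"

text \<open>When \<open>j\<close> and \<open>i + 1 - int k - j\<close> are the actual counts of 12
  in the parts, every exponent of \<open>join_factor\<close> is a natural number, and the claim
  becomes \<open>weight_join\<close>.\<close>

lemma weight_join_laurent:
  fixes n k :: nat and i j :: int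
  assumes L: "L \<in> permutations_of_set {1..k - 1}" and R: "R \<in> permutations_of_set {1..n - k}"
    and k: "k \<in> {1..n}" and j: "int (occr [1,2] L) = j" and i: "int (occr [1,2] R) = i + 1 - int k - j"
  shows "join_factor n k i j *
             weight
               [X 1 * Y 1 * Y 4 ^ (n - k),
                X 2 * Y 2 * Y 7 ^ (n - k),
                X 3 * Y 3 * Y 9 ^ (n - k),
                X 4 * Y 5 * Y 12 ^ (n - k),
                X 5 * Y 6 * Y 14 ^ (n - k)] yvars L *
             weight
               [X 1 * Y 10 ^ k, X 2 * Y 11 ^ k, X 3 * Y 12 ^ k,
                X 4 * Y 13 ^ k, X 5 * Y 14 ^ k] yvars R
      = weight xvars yvars (join L R)"
proof -
  define a b c d m r where "a = occr [1,2] L" and "b = occr [2,1] L"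
    and "c = occr [1,2] R" and "d = occr [2,1] R" and "m = k - 1" and "r = n - k"
  have km: "k = Suc m"
    using k by (simp add: m_def)
  have "length L = m" "length R = r"
    using perm_atLeastAtMostD[OF L] perm_atLeastAtMostD[OF R] by (simp_all add: m_def r_def)
  then have ab: "choose2 m = int a + int b" and cd: "choose2 r = int c + int d"
    using occr_12_add_21[of L] occr_12_add_21[of R] perm_atLeastAtMostD[OF L] perm_atLeastAtMostD[OF R]
    by (auto simp: a_def b_def c_def d_def simp flip: of_nat_add)
  have i': "i = int a + int m + int c" and j': "j = int a"
    using i j by (simp_all add: a_def c_def km)
  \<comment> \<open>The integer differences are rewritten as casts of counts, so that Laurent
    monomials turn into ordinary powers and both sides become syntactically equal.\<close>
  have e: "choose2 (k - 1) - j = int b" "i + 1 - int k - j = int c" "int k + j - 1 = int (m + a)"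
    "choose2 (n - k) + int k + j - i - 1 = int d" "j + int k - 1 = int (a + m)"
    unfolding m_def [symmetric] r_def [symmetric] by (simp_all add: ab cd i' j' km)
  show ?thesis
    unfolding join_factor_def e
    unfolding km [THEN arg_cong, of int] j' r_def [symmetric] of_nat_mult [symmetric]
      of_nat_add [symmetric] xpow_of_nat ypow_of_nat xvars_def yvars_def
    unfolding weight_join[OF L R, folded m_def r_def, folded a_def b_def c_def d_def] km
    by (rule refl)
qed

section \<open>Vanishing, initial value and recurrence\<close>

lemma Q_out_of_range:
  assumes "i < 0 \<or> choose2 n < i"
  shows "Q n i xs ys = 0"
proof -
  have "int (occr [1,2] \<sigma>) \<noteq> i" if "\<sigma> \<in> S132 n" for \<sigma>
  proof -
    have "\<sigma> \<in> permutations_of_set {1..n}"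
      using that by (simp add: S132_def)
    then have "occr [1,2] \<sigma> \<le> n choose 2"
      using perm_atLeastAtMostD[of \<sigma> n] occr_12_add_21[of \<sigma>] by simp
    then show ?thesis
      using assms by linarith
  qed
  then show ?thesis
    by (simp add: Q_eq_sum_weight)
qed

lemma Q_0_0: "Q 0 0 xvars yvars = 1"
proof -
  have "S132 0 = {[]}"
    by (auto simp: S132_def occr_Nil_right)
  then show ?thesis
    by (simp add: Q_eq_sum_weight occr_Nil_right xvars_def yvars_def weight_expand)
qed

text \<open>Each pair \<open>L\<close>, \<open>R\<close> contributes for a single \<open>j\<close>,
  the count of 12 in \<open>L\<close>. Thus \<open>F\<close> matters only at actual counts, which
  keeps negative exponents out of the recurrence.\<close>

lemma Q_convolution:
  fixes F :: "int \<Rightarrow> 'a::comm_semiring_1"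
  shows "(\<Sum>j = 0..t. F j * Q m j xs ys * Q r (t - j) xs' ys') =
    (\<Sum>L\<in>S132 m. \<Sum>R\<in>S132 r. if int (occr [1,2] L) + int (occr [1,2] R) = t
      then F (int (occr [1,2] L)) * weight xs ys L * weight xs' ys' R else 0)"
proof -
  have "(\<Sum>j = 0..t. F j * Q m j xs ys * Q r (t - j) xs' ys') =
      (\<Sum>j = 0..t. \<Sum>L\<in>S132 m. \<Sum>R\<in>S132 r.
        if int (occr [1,2] L) = j then
          if int (occr [1,2] L) + int (occr [1,2] R) = t
          then F (int (occr [1,2] L)) * weight xs ys L * weight xs' ys' R else 0
        else 0)"
    unfolding Q_eq_sum_weight mult.assoc sum_product unfolding sum_distrib_left
    by (intro sum.cong refl) auto
  also have "\<dots> = (\<Sum>L\<in>S132 m. \<Sum>R\<in>S132 r. \<Sum>j = 0..t.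
        if int (occr [1,2] L) = j then
          if int (occr [1,2] L) + int (occr [1,2] R) = t
          then F (int (occr [1,2] L)) * weight xs ys L * weight xs' ys' R else 0
        else 0)"
    by (subst sum.swap, intro sum.cong refl, subst sum.swap, rule refl)
  also have "\<dots> = (\<Sum>L\<in>S132 m. \<Sum>R\<in>S132 r. if int (occr [1,2] L) + int (occr [1,2] R) = t
      then F (int (occr [1,2] L)) * weight xs ys L * weight xs' ys' R else 0)"
    \<comment> \<open>If the two counts sum to \<open>t\<close>, nonnegativity puts the selected
      \<open>j\<close> into the range \<open>0..t\<close>; otherwise the term is 0 anyway.\<close>
    by (intro sum.cong refl) (auto simp: sum.delta)
  finally show ?thesis .
qed

theorem theorem5:
  shows
    "Q 0 0 xvars yvars = 1 \<and>
     (\<forall>(n::nat) (i::int). i < 0 \<or> i > choose2 n \<longrightarrow> Q n i xvars yvars = 0) \<and>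
     (\<forall>(n::nat) (i::int). n \<ge> 1 \<longrightarrow> 0 \<le> i \<longrightarrow> i \<le> choose2 n \<longrightarrow>
        Q n i xvars yvars =
          (\<Sum>k::nat = 1..n. \<Sum>j::int = 0..i + 1 - int k.
             xpow 1 j *
             xpow 2 (choose2 (k - 1) - j) *
             xpow 3 (int (n - k) * (int k + j - 1)) *
             xpow 4 (int k * (i + 1 - int k - j)) *
             xpow 5 (int (n - k) * (choose2 (k - 1) - j)
                     + int k * (choose2 (n - k) + int k + j - i - 1)) *
             ypow 4 (j * int (n - k)) *
             ypow 7 ((choose2 (k - 1) - j) * int (n - k)) *
             ypow 8 ((j + int k - 1) * (i + 1 - int k - j)) *
             ypow 9 ((j + int k - 1) * (choose2 (n - k) + int k + j - i - 1)) *
             ypow 13 ((choose2 (k - 1) - j) * (i + 1 - int k - j)) *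
             ypow 14 ((choose2 (k - 1) - j) * (choose2 (n - k) + int k + j - i - 1)) *
             Q (k - 1) j
               [X 1 * Y 1 * Y 4 ^ (n - k),
                X 2 * Y 2 * Y 7 ^ (n - k),
                X 3 * Y 3 * Y 9 ^ (n - k),
                X 4 * Y 5 * Y 12 ^ (n - k),
                X 5 * Y 6 * Y 14 ^ (n - k)] yvars *
             Q (n - k) (i + 1 - int k - j)
               [X 1 * Y 10 ^ k, X 2 * Y 11 ^ k, X 3 * Y 12 ^ k,
                X 4 * Y 13 ^ k, X 5 * Y 14 ^ k] yvars))"
proof (intro conjI allI impI)
  show "Q 0 0 xvars yvars = 1"
    by (rule Q_0_0)
next
  fix n :: nat and i :: int
  assume "i < 0 \<or> i > choose2 n"
  then show "Q n i xvars yvars = 0"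
    by (rule Q_out_of_range)
next
  fix n :: nat and i :: int
  assume "1 \<le> n"
  have "Q n i xvars yvars = (\<Sum>(k, L, R)\<in>(SIGMA k:{1..n}. S132 (k - 1) \<times> S132 (n - k)).
      if int (occr [1,2] (join L R)) = i then weight xvars yvars (join L R) else 0)"
    unfolding Q_eq_sum_weight sum.reindex_bij_betw[OF bij_betw_join_S132[OF \<open>1 \<le> n\<close>], symmetric]
    by (simp only: case_prod_unfold)
  also have "\<dots> = (\<Sum>k = 1..n. \<Sum>L\<in>S132 (k - 1). \<Sum>R\<in>S132 (n - k).
      if int (occr [1,2] (join L R)) = i then weight xvars yvars (join L R) else 0)"
    by (simp only: sum.cartesian_product) (subst sum.Sigma, auto)
  finally have Q_eq: "Q n i xvars yvars = \<dots>" .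
  show "Q n i xvars yvars =
          (\<Sum>k::nat = 1..n. \<Sum>j::int = 0..i + 1 - int k.
             xpow 1 j *
             xpow 2 (choose2 (k - 1) - j) *
             xpow 3 (int (n - k) * (int k + j - 1)) *
             xpow 4 (int k * (i + 1 - int k - j)) *
             xpow 5 (int (n - k) * (choose2 (k - 1) - j)
                     + int k * (choose2 (n - k) + int k + j - i - 1)) *
             ypow 4 (j * int (n - k)) *
             ypow 7 ((choose2 (k - 1) - j) * int (n - k)) *
             ypow 8 ((j + int k - 1) * (i + 1 - int k - j)) *
             ypow 9 ((j + int k - 1) * (choose2 (n - k) + int k + j - i - 1)) *
             ypow 13 ((choose2 (k - 1) - j) * (i + 1 - int k - j)) *
             ypow 14 ((choose2 (k - 1) - j) * (choose2 (n - k) + int k + j - i - 1)) *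
             Q (k - 1) j
               [X 1 * Y 1 * Y 4 ^ (n - k),
                X 2 * Y 2 * Y 7 ^ (n - k),
                X 3 * Y 3 * Y 9 ^ (n - k),
                X 4 * Y 5 * Y 12 ^ (n - k),
                X 5 * Y 6 * Y 14 ^ (n - k)] yvars *
             Q (n - k) (i + 1 - int k - j)
               [X 1 * Y 10 ^ k, X 2 * Y 11 ^ k, X 3 * Y 12 ^ k,
                X 4 * Y 13 ^ k, X 5 * Y 14 ^ k] yvars)"
    \<comment> \<open>For each \<open>k\<close>, the inner sum is the convolution with
      \<open>t = i + 1 - int k\<close> and \<open>F = join_factor n k i\<close>.\<close>
    unfolding join_factor_def [symmetric] Q_eq Q_convolution
  proof (intro sum.cong refl)
    fix k L R assume k: "k \<in> {1..n}" and "L \<in> S132 (k - 1)" "R \<in> S132 (n - k)"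
    then have L: "L \<in> permutations_of_set {1..k - 1}" and R: "R \<in> permutations_of_set {1..n - k}"
      by (simp_all add: S132_def)
    \<comment> \<open>The maximum forms a 12 with each of the \<open>k - 1\<close> entries before
      it, which accounts for the shift from \<open>i\<close> to
      \<open>i + 1 - int k\<close>.\<close>
    have iff: "int (occr [1,2] (join L R)) = i \<longleftrightarrow>
        int (occr [1,2] L) + int (occr [1,2] R) = i + 1 - int k"
      using k by (simp only: occr_join_patterns(2)[OF L R]) auto
    show "(if int (occr [1,2] (join L R)) = i then weight xvars yvars (join L R) else 0) =
        (if int (occr [1,2] L) + int (occr [1,2] R) = i + 1 - int k
         then join_factor n k i (int (occr [1,2] L)) *
             weight
               [X 1 * Y 1 * Y 4 ^ (n - k),
                X 2 * Y 2 * Y 7 ^ (n - k),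
                X 3 * Y 3 * Y 9 ^ (n - k),
                X 4 * Y 5 * Y 12 ^ (n - k),
                X 5 * Y 6 * Y 14 ^ (n - k)] yvars L *
             weight
               [X 1 * Y 10 ^ k, X 2 * Y 11 ^ k, X 3 * Y 12 ^ k,
                X 4 * Y 13 ^ k, X 5 * Y 14 ^ k] yvars R
         else 0)"
      unfolding iff by (intro if_cong refl weight_join_laurent[OF L R k refl, symmetric]) linarith
  qed
qed

end
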